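(* Let $F\in\mathcal P_d$ form an $(h,\kappa,\eta,m,M)$-regular cluster. Set $\epsilon'=(1+|\kappa|)^{-2d+1}\epsilon$ and $h'=\frac h{1+|\kappa|}$. Then for each positive $\epsilon\le h'^{\,2d-1}R$ and each $q=0,\dots,2d-1$, $$C_3\,\epsilon'\left(\frac1h\right)^q\le\bar\rho_q(F,\epsilon)\le C_4\,\epsilon\left(\frac1{h'}\right)^q,$$ where $R,C_3,C_4>0$ are the constants, depending only on $d,\eta,m,M$, described in the context.
   Context: Let $d\ge2$. $\mathcal P_d$ is the set of $F=(a,x)\in\mathbb R^d\times\mathbb R^d$ with $x_1<\dots<x_d$ and all $a_j\ne0$; $F$ is identified with $F(x)=\sum_j a_j\delta(x-x_j)$. Moments: $m_k(F)=\sum_{j=1}^d a_jx_j^k$. All norms are maximum norms: $\|F\|=\max(\|a\|,\|x\|)$, $\|v\|=\max_j|v_j|$. Put $h(F)=\frac12(x_d-x_1)$, $\kappa(F)=\frac12(x_1+x_d)$. For $0<m\le M$ and $\eta>0$, $F$ forms an $(h,\kappa,\eta,m,M)$-regular cluster if $h=h(F)\le\frac12$, $\kappa=\kappa(F)$, $m\le|a_j|\le M$ for all $j$, and $x_{j+1}-x_j\ge\eta h$ for $j=1,\dots,d-1$. The normalization is $\Psi_{\kappa,h}(a,x)=(a,\bar x)$, $\bar x_j=\frac1h(x_j-\kappa)$; $G=\Psi_{\kappa,h}(F)$ is the model signal of $F$. Error set: $E_\epsilon(F)=\{F'\in\mathcal P_d: |m_k(F')-m_k(F)|\le\epsilon,\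 k=0,\dots,2d-1\}$; normalized error set: $\bar E_\epsilon(F)=\Psi_{\kappa,h}(E_\epsilon(F))$. For $\epsilon,\alpha>0$: $\Pi_{\epsilon,\alpha}(G)=\{G'\in\mathcal P_d: |m_k(G')-m_k(G)|\le\epsilon\alpha^k,\ k=0,\dots,2d-1\}$. For a signal $G'$, the Prony variety $S_q(G')$ is the set of $(a,x)\in\mathbb R^d\times\mathbb R^d$ with $\sum_j a_jx_j^k=m_k(G')$, $k=0,\dots,q$. With $G$ the model signal of $F$ and $h'=h/(1+|\kappa|)$, for $G'\in\bar E_\epsilon(F)$ (including $G'=G$) put $S^\pi_{q,\epsilon}(G')=S_q(G')\cap\Pi_{\epsilon,\frac1{h'}}(G)$. The worst case error in reconstruction of the local Prony variety is $$\bar\rho_q(F,\epsilon)=\max_{G'\in\bar E_\epsilon(F)}d_H\big(S^\pi_{q,\epsilon}(G),S^\pi_{q,\epsilon}(G')\big),$$ where $d_H(A,B)=\max\{\sup_{u\in A}\inf_{v\in B}\|u-v\|,\ \sup_{u\in B}\inf_{v\in A}\|u-v\|\}$ is the Hausdorff distance for the maximum norm. Constants: let $PM:\mathcal P_d\to\mathbb R^{2d}$, $PM(F)=(m_0(F),\dots,m_{2d-1}(F))$, and $Q_R(\nu)=\{\nu':\|\nu'-\nu\|\le R\}$. A signal in $\mathcal P_d$ is $(\eta,m,M)$-regular if its nodes lie in $[-1,1]$, neighboring nodes are at distance at least $\eta$, and its amplitudes satisfy $m\le|a_j|\le M$. The positive constants $R,C_3,C_4$, depending only on $d,\eta,m,M$,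 are such that for every $(\eta,m,M)$-regular $G$ with $\nu=PM(G)$, the inverse $PM^{-1}$ exists on $Q_R(\nu)$, is a diffeomorphism of $Q_R(\nu)$ onto $PM^{-1}(Q_R(\nu))$, and $C_3\|\nu''-\nu'\|\le\|PM^{-1}(\nu'')-PM^{-1}(\nu')\|\le C_4\|\nu''-\nu'\|$ for all $\nu',\nu''\in Q_R(\nu)$ (such constants exist). *)

theory Defs
  imports "HOL-Analysis.Analysis"
begin

text \<open>
  A signal is a pair of amplitudes and nodes \<open>(a, x)\<close>. The indices \<open>1 < \<dots> < d\<close> are the elements of
  a finite linearly ordered type \<open>'d\<close>, so \<open>d\<close> is \<open>CARD('d)\<close> and indices \<open>1\<close> and \<open>d\<close> are the minimum
  and maximum of \<open>UNIV\<close>. The maximum norm is \<open>infnorm\<close>; the norm of \<open>real ^ 'd\<close>, and of the product,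
  is Euclidean and is not used.
\<close>

type_synonym 'd signal = "(real ^ 'd) \<times> (real ^ 'd)"

lemma infnorm_vec_eq_Max: "infnorm (v :: real ^ 'n) = (MAX j. \<bar>v $ j\<bar>)"
  by (simp add: infnorm_cart cSup_eq_Max full_SetCompr_eq)

lemma infnorm_signal_eq_max: "infnorm (a :: real ^ 'd, x :: real ^ 'd) = max (infnorm a) (infnorm x)"
proof -
  have "(\<lambda>b. \<bar>(a, x) \<bullet> b\<bar>) ` Basis = (\<lambda>b. \<bar>a \<bullet> b\<bar>) ` Basis \<union> (\<lambda>b. \<bar>x \<bullet> b\<bar>) ` Basis"
    by (auto simp: Basis_prod_def image_Un image_image)
  then show ?thesis
    by (simp add: infnorm_Max Max_Un)
qed

definition signals :: "'d::{finite,linorder} signal set" where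
  "signals = {(a, x). strict_mono (\<lambda>j. x $ j) \<and> (\<forall>j. a $ j \<noteq> 0)}"

definition moment :: "nat \<Rightarrow> 'd::finite signal \<Rightarrow> real" where
  "moment k F = (\<Sum>j\<in>UNIV. fst F $ j * (snd F $ j) ^ k)"

definition half_width :: "'d::{finite,linorder} signal \<Rightarrow> real" where
  "half_width F = (snd F $ Max UNIV - snd F $ Min UNIV) / 2"

definition center :: "'d::{finite,linorder} signal \<Rightarrow> real" where
  "center F = (snd F $ Min UNIV + snd F $ Max UNIV) / 2"

definition neighbors :: "'d::linorder \<Rightarrow> 'd \<Rightarrow> bool" where
  "neighbors i j \<longleftrightarrow> i < j \<and> \<not> (\<exists>k. i < k \<and> k < j)"

definition regular_cluster ::
    "real \<Rightarrow> real \<Rightarrow> real \<Rightarrow> real \<Rightarrow> real \<Rightarrow> 'd::{finite,linorder} signal \<Rightarrow> bool" where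
  "regular_cluster h \<kappa> \<eta> m M F \<longleftrightarrow>
     F \<in> signals \<and> h = half_width F \<and> h \<le> 1 / 2 \<and> \<kappa> = center F \<and>
     (\<forall>j. m \<le> \<bar>fst F $ j\<bar> \<and> \<bar>fst F $ j\<bar> \<le> M) \<and>
     (\<forall>i j. neighbors i j \<longrightarrow> snd F $ j - snd F $ i \<ge> \<eta> * h)"

definition normalize_signal :: "real \<Rightarrow> real \<Rightarrow> 'd::finite signal \<Rightarrow> 'd signal" where
  "normalize_signal \<kappa> h F = (fst F, \<chi> j. (snd F $ j - \<kappa>) / h)"

definition model_signal :: "'d::{finite,linorder} signal \<Rightarrow> 'd signal" where
  "model_signal F = normalize_signal (center F) (half_width F) F"

definition error_set :: "real \<Rightarrow> 'd::{finite,linorder} signal \<Rightarrow> 'd signal set" where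
  "error_set \<epsilon> F =
     {F' \<in> signals. \<forall>k \<le> 2 * CARD('d) - 1. \<bar>moment k F' - moment k F\<bar> \<le> \<epsilon>}"

text \<open>All members of the error set are normalized with the center and width of \<open>F\<close>, not their own.\<close>

definition normalized_error_set :: "real \<Rightarrow> 'd::{finite,linorder} signal \<Rightarrow> 'd signal set" where
  "normalized_error_set \<epsilon> F = normalize_signal (center F) (half_width F) ` error_set \<epsilon> F"

definition moment_box :: "real \<Rightarrow> real \<Rightarrow> 'd::{finite,linorder} signal \<Rightarrow> 'd signal set" where
  "moment_box \<epsilon> \<alpha> G =
     {G' \<in> signals. \<forall>k \<le> 2 * CARD('d) - 1. \<bar>moment k G' - moment k G\<bar> \<le> \<epsilon> * \<alpha> ^ k}"

text \<open>Points of the Prony variety need not have ordered nodes or nonzero amplitudes.\<close>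

definition prony_variety :: "nat \<Rightarrow> 'd::finite signal \<Rightarrow> 'd signal set" where
  "prony_variety q G = {u. \<forall>k \<le> q. moment k u = moment k G}"

definition scaled_width :: "'d::{finite,linorder} signal \<Rightarrow> real" where
  "scaled_width F = half_width F / (1 + \<bar>center F\<bar>)"

definition local_prony_variety ::
    "nat \<Rightarrow> real \<Rightarrow> 'd::{finite,linorder} signal \<Rightarrow> 'd signal \<Rightarrow> 'd signal set" where
  "local_prony_variety q \<epsilon> F G' =
     prony_variety q G' \<inter> moment_box \<epsilon> (1 / scaled_width F) (model_signal F)"

definition hausdorff_distance :: "'a::euclidean_space set \<Rightarrow> 'a set \<Rightarrow> ennreal" where
  "hausdorff_distance A B =
     max (SUP u\<in>A. INF v\<in>B. ennreal (infnorm (u - v)))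
         (SUP u\<in>B. INF v\<in>A. ennreal (infnorm (u - v)))"

text \<open>
  The worst case error is a maximum over an infinite set: \<open>Greatest\<close> denotes the largest value, and is
  unspecified unless the supremum is attained.
\<close>

definition worst_prony_error :: "nat \<Rightarrow> 'd::{finite,linorder} signal \<Rightarrow> real \<Rightarrow> ennreal" where
  "worst_prony_error q F \<epsilon> =
     (GREATEST r. r \<in> (\<lambda>G'. hausdorff_distance (local_prony_variety q \<epsilon> F (model_signal F))
                                                 (local_prony_variety q \<epsilon> F G'))
                      ` normalized_error_set \<epsilon> F)"

text \<open>
  The moment space \<open>\<real>\<^sup>2\<^sup>d\<close> is indexed by \<open>'d bit0\<close>, whose elements are represented by the integers
  \<open>0, \<dots>, 2 * CARD('d) - 1\<close>.
\<close>

definition PM :: "'d::finite signal \<Rightarrow> real ^ ('d bit0)" where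
  "PM F = (\<chi> k. moment (nat (Rep_bit0 k)) F)"

definition cube :: "real \<Rightarrow> real ^ 'n \<Rightarrow> (real ^ 'n) set" where
  "cube R \<nu> = {\<nu>'. infnorm (\<nu>' - \<nu>) \<le> R}"

definition regular_signal ::
    "real \<Rightarrow> real \<Rightarrow> real \<Rightarrow> 'd::{finite,linorder} signal \<Rightarrow> bool" where
  "regular_signal \<eta> m M G \<longleftrightarrow>
     G \<in> signals \<and> (\<forall>j. snd G $ j \<in> {-1..1}) \<and>
     (\<forall>i j. neighbors i j \<longrightarrow> snd G $ j - snd G $ i \<ge> \<eta>) \<and>
     (\<forall>j. m \<le> \<bar>fst G $ j\<bar> \<and> \<bar>fst G $ j\<bar> \<le> M)"

text \<open>
  \<open>Ck_on\<close> is \<open>C\<^sup>k\<close> on an open set, by recursion on directional derivatives (the domain is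
  finite dimensional). A map on an arbitrary set is smooth if it extends to a smooth map on an open
  neighborhood; this gives the usual meaning on a closed cube.
\<close>

primrec Ck_on :: "nat \<Rightarrow> ('a::euclidean_space \<Rightarrow> 'b::euclidean_space) \<Rightarrow> 'a set \<Rightarrow> bool" where
  "Ck_on 0 f U \<longleftrightarrow> continuous_on U f"
| "Ck_on (Suc k) f U \<longleftrightarrow>
     (\<exists>f'. (\<forall>x\<in>U. (f has_derivative f' x) (at x)) \<and> (\<forall>v. Ck_on k (\<lambda>x. f' x v) U))"

definition smooth_map_on :: "'a::euclidean_space set \<Rightarrow> ('a \<Rightarrow> 'b::euclidean_space) \<Rightarrow> bool" where
  "smooth_map_on A f \<longleftrightarrow>
     (\<exists>U g. open U \<and> A \<subseteq> U \<and> (\<forall>x\<in>A. g x = f x) \<and> (\<forall>k. Ck_on k g U))"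

definition diffeomorphism_betw ::
    "('a::euclidean_space \<Rightarrow> 'b::euclidean_space) \<Rightarrow> 'a set \<Rightarrow> 'b set \<Rightarrow> bool" where
  "diffeomorphism_betw f A B \<longleftrightarrow>
     bij_betw f A B \<and> smooth_map_on A f \<and> smooth_map_on B (inv_into A f)"

definition PM_inv :: "real ^ ('d bit0) \<Rightarrow> 'd::{finite,linorder} signal" where
  "PM_inv = inv_into signals PM"

text \<open>The type argument expresses that the constants depend on \<open>d\<close> but not on any signal.\<close>

definition inversion_constants ::
    "'d::{finite,linorder} itself \<Rightarrow> real \<Rightarrow> real \<Rightarrow> real \<Rightarrow> real \<Rightarrow> real \<Rightarrow> real \<Rightarrow> bool" where
  "inversion_constants TYPE('d) \<eta> m M R C3 C4 \<longleftrightarrow>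
     0 < R \<and> 0 < C3 \<and> 0 < C4 \<and>
     (\<forall>G :: 'd signal. regular_signal \<eta> m M G \<longrightarrow>
        (\<forall>\<nu> \<in> cube R (PM G). \<exists>!F. F \<in> signals \<and> PM F = \<nu>) \<and>
        diffeomorphism_betw (PM_inv :: _ \<Rightarrow> 'd signal) (cube R (PM G))
          {F \<in> signals. PM F \<in> cube R (PM G)} \<and>
        (\<forall>\<nu>' \<in> cube R (PM G). \<forall>\<nu>'' \<in> cube R (PM G).
           C3 * infnorm (\<nu>'' - \<nu>') \<le> infnorm ((PM_inv \<nu>'' :: 'd signal) - PM_inv \<nu>') \<and>
           infnorm ((PM_inv \<nu>'' :: 'd signal) - PM_inv \<nu>') \<le> C4 * infnorm (\<nu>'' - \<nu>')))"

end

theory Submission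
  imports Defs
begin

text \<open>
  In the moment space of the model signal \<open>G\<close>, the error set of \<open>F\<close> becomes a parallelepiped, the affine
  image of a cube, whose \<open>k\<close>-th coordinates differ from those of \<open>G\<close> by at most \<open>\<epsilon> (1 / h') ^ k \<le> R\<close>. There
  the inverse of the moment map is bi-Lipschitz, and the local Prony varieties are the images of the
  slices of a box on which the first \<open>q + 1\<close> coordinates are fixed. Changing only those coordinates
  moves a point from one slice to another, which gives the upper bound and also shows that the
  Hausdorff distance is Lipschitz in the moments, so that its maximum over the compact parallelepiped
  is attained. For the lower bound, change the \<open>q\<close>-th moment of \<open>F\<close> by \<open>\<epsilon>\<close> and no other: the \<open>q\<close>-th
  moment of the model changes by \<open>\<epsilon> / h ^ q\<close>, which separates the two varieties.
\<close>

section \<open>Maximum-norm cubes and coordinates of the moment space\<close>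

lemma infnorm_vec_le_iff: "infnorm (v :: real ^ 'n) \<le> B \<longleftrightarrow> (\<forall>j. \<bar>v $ j\<bar> \<le> B)"
  by (auto simp: infnorm_vec_eq_Max)

lemma component_le_infnorm_vec: "\<bar>(v :: real ^ 'n) $ j\<bar> \<le> infnorm v"
  using infnorm_vec_le_iff by blast

lemma compact_cube: "compact (cube R \<nu>)"
proof -
  have eq: "cube R \<nu> = {\<nu> - (\<chi> j. R)..\<nu> + (\<chi> j. R)}"
    by (auto simp: cube_def infnorm_vec_le_iff less_eq_vec_def abs_le_iff algebra_simps)
  show ?thesis
    unfolding eq by (simp add: interval_cbox)
qed

text \<open>Moment data are mostly kept as functions of a natural index, which suits binomial sums;
  vectors over \<open>'d bit0\<close> enter for compactness and for the inverse moment map.\<close>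

definition moment_vector :: "(nat \<Rightarrow> real) \<Rightarrow> real ^ ('d::finite bit0)" where
  "moment_vector f = (\<chi> k. f (nat (Rep_bit0 k)))"

text \<open>Meaningful only for \<open>i < 2 * CARD('d)\<close>: outside this range \<open>Abs_bit0\<close> is unspecified.\<close>

definition moment_entry :: "real ^ ('d::finite bit0) \<Rightarrow> nat \<Rightarrow> real" where
  "moment_entry v i = v $ Abs_bit0 (int i)"

lemma PM_eq_moment_vector: "PM F = moment_vector (\<lambda>k. moment k F)"
  by (simp add: PM_def moment_vector_def)

lemma nat_Rep_bit0_le: "nat (Rep_bit0 (k :: 'd::finite bit0)) \<le> 2 * CARD('d) - 1"
  using Rep_bit0[of k] by auto

lemma nat_Rep_bit0_Abs_bit0:
  assumes "i \<le> 2 * CARD('d::finite) - 1"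
  shows "nat (Rep_bit0 (Abs_bit0 (int i) :: 'd bit0)) = i"
proof -
  \<comment> \<open>Subtraction is truncated, so positivity is what makes the bound on
    \<open>i\<close> strict.\<close>
  have "CARD('d) > 0" by simp
  with assms have "int i < 2 * int CARD('d)" by linarith
  then show ?thesis by (simp add: Abs_bit0_inverse)
qed

lemma all_moment_index:
  "(\<forall>k :: 'd::finite bit0. P (nat (Rep_bit0 k))) \<longleftrightarrow> (\<forall>k \<le> 2 * CARD('d) - 1. P k)"
  by (metis nat_Rep_bit0_le nat_Rep_bit0_Abs_bit0)

lemma moment_entry_moment_vector:
  "i \<le> 2 * CARD('d::finite) - 1 \<Longrightarrow> moment_entry (moment_vector f :: real ^ ('d bit0)) i = f i"
  by (simp add: moment_entry_def moment_vector_def nat_Rep_bit0_Abs_bit0)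

lemma moment_vector_diff_nth:
  "(moment_vector f - moment_vector g) $ k = f (nat (Rep_bit0 k)) - g (nat (Rep_bit0 k))"
  by (simp add: moment_vector_def)

lemma infnorm_moment_vector_diff_le_iff:
  "infnorm (moment_vector f - moment_vector g :: real ^ ('d::finite bit0)) \<le> B \<longleftrightarrow>
     (\<forall>k \<le> 2 * CARD('d) - 1. \<bar>f k - g k\<bar> \<le> B)"
  unfolding infnorm_vec_le_iff moment_vector_diff_nth by (rule all_moment_index)

lemma abs_moment_entry_diff_le: "\<bar>moment_entry v i - moment_entry w i\<bar> \<le> infnorm (v - w)"
  using component_le_infnorm_vec[of "v - w"] by (simp add: moment_entry_def)

lemma mem_cube_PM_iff:
  "moment_vector f \<in> cube R (PM (G :: 'd::finite signal)) \<longleftrightarrow>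
     (\<forall>k \<le> 2 * CARD('d) - 1. \<bar>f k - moment k G\<bar> \<le> R)"
  by (simp add: cube_def PM_eq_moment_vector infnorm_moment_vector_diff_le_iff)

section \<open>Inversion of the moment map near a regular signal\<close>

lemma signal_with_moments:
  fixes G :: "'d::{finite,linorder} signal"
  assumes "inversion_constants TYPE('d) \<eta> m M R C3 C4" "regular_signal \<eta> m M G"
    and "\<And>k. k \<le> 2 * CARD('d) - 1 \<Longrightarrow> \<bar>f k - moment k G\<bar> \<le> R"
  obtains G' :: "'d signal" where "G' \<in> signals"
    "\<And>k. k \<le> 2 * CARD('d) - 1 \<Longrightarrow> moment k G' = f k"
proof -
  have "moment_vector f \<in> cube R (PM G)"
    using assms(3) by (simp add: mem_cube_PM_iff)
  then obtain G' :: "'d signal" where G': "G' \<in> signals" "PM G' = moment_vector f"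
    using assms(1,2) unfolding inversion_constants_def by blast
  have "moment k G' = f k" if "k \<le> 2 * CARD('d) - 1" for k
    using moment_entry_moment_vector[OF that] G'(2) unfolding PM_eq_moment_vector by metis
  with G'(1) show thesis by (rule that)
qed

text \<open>The bi-Lipschitz estimates for \<open>PM_inv\<close>, read on signals with moments in
  the cube. For the lower estimate one coordinate suffices, since it never exceeds the norm.\<close>

lemma signal_diff_moment_bounds:
  fixes A B G :: "'d::{finite,linorder} signal"
  assumes ic: "inversion_constants TYPE('d) \<eta> m M R C3 C4" and reg: "regular_signal \<eta> m M G"
    and A: "A \<in> signals" "\<And>k. k \<le> 2 * CARD('d) - 1 \<Longrightarrow> \<bar>moment k A - moment k G\<bar> \<le> R"
    and B: "B \<in> signals" "\<And>k. k \<le> 2 * CARD('d) - 1 \<Longrightarrow> \<bar>moment k B - moment k G\<bar> \<le> R"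
  shows "k \<le> 2 * CARD('d) - 1 \<Longrightarrow> C3 * \<bar>moment k A - moment k B\<bar> \<le> infnorm (A - B)"
    and "(\<And>k. k \<le> 2 * CARD('d) - 1 \<Longrightarrow> \<bar>moment k A - moment k B\<bar> \<le> D) \<Longrightarrow>
           infnorm (A - B) \<le> C4 * D"
proof -
  let ?Q = "cube R (PM G)"
  have in_cube: "PM A \<in> ?Q" "PM B \<in> ?Q"
    using A(2) B(2) mem_cube_PM_iff[of _ R G] unfolding PM_eq_moment_vector[of A] PM_eq_moment_vector[of B]
    by blast+
  have unique: "\<exists>!F. F \<in> signals \<and> PM F = \<nu>" if "\<nu> \<in> ?Q" for \<nu>
    using ic reg that unfolding inversion_constants_def by blast
  \<comment> \<open>\<open>PM_inv\<close> chooses some preimage in \<open>signals\<close>;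
    uniqueness forces the choice to be \<open>X\<close>.\<close>
  have inverse: "PM_inv (PM X) = X" if "X \<in> signals" "PM X \<in> ?Q" for X :: "'d signal"
    unfolding PM_inv_def
    using unique[OF that(2)] that(1) inv_into_into[of "PM X" PM signals] f_inv_into_f[of "PM X" PM signals]
    by blast
  have pos: "0 < C3" "0 < C4"
    using ic by (simp_all add: inversion_constants_def)
  have "\<forall>\<nu>' \<in> ?Q. \<forall>\<nu>'' \<in> ?Q.
      C3 * infnorm (\<nu>'' - \<nu>') \<le> infnorm ((PM_inv \<nu>'' :: 'd signal) - PM_inv \<nu>') \<and>
      infnorm ((PM_inv \<nu>'' :: 'd signal) - PM_inv \<nu>') \<le> C4 * infnorm (\<nu>'' - \<nu>')"
    using ic[unfolded inversion_constants_def] reg by blast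
  from bspec[OF bspec[OF this in_cube(2)] in_cube(1)]
  have bounds: "C3 * infnorm (PM A - PM B) \<le> infnorm (A - B)"
      "infnorm (A - B) \<le> C4 * infnorm (PM A - PM B)"
    by (simp_all add: inverse A(1) B(1) in_cube)
  show "C3 * \<bar>moment k A - moment k B\<bar> \<le> infnorm (A - B)" if "k \<le> 2 * CARD('d) - 1"
  proof -
    have "\<bar>moment k A - moment k B\<bar> \<le> infnorm (PM A - PM B)"
      using abs_moment_entry_diff_le[of "PM A" k "PM B"] that
      by (simp add: PM_eq_moment_vector moment_entry_moment_vector)
    with bounds(1) pos(1) show ?thesis
      by (meson mult_left_mono less_imp_le order_trans)
  qed
  show "infnorm (A - B) \<le> C4 * D"
    if "\<And>k. k \<le> 2 * CARD('d) - 1 \<Longrightarrow> \<bar>moment k A - moment k B\<bar> \<le> D"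
  proof -
    have "infnorm (PM A - PM B) \<le> D"
      using that by (simp add: PM_eq_moment_vector infnorm_moment_vector_diff_le_iff)
    with bounds(2) pos(2) show ?thesis
      by (meson mult_left_mono less_imp_le order_trans)
  qed
qed

section \<open>Moments under translation and scaling of the nodes\<close>

text \<open>Stated for arbitrary sequences because it is also applied to sequences not yet known to
  be the moments of a signal.\<close>

definition moment_shift :: "real \<Rightarrow> real \<Rightarrow> (nat \<Rightarrow> real) \<Rightarrow> nat \<Rightarrow> real" where
  "moment_shift \<kappa> h w k = (\<Sum>i\<le>k. of_nat (k choose i) * (- \<kappa>) ^ (k - i) * w i) / h ^ k"

lemma moment_normalize_signal:
  "moment k (normalize_signal \<kappa> h F) = moment_shift \<kappa> h (\<lambda>i. moment i F) k"
proof -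
  have expand: "((x - \<kappa>) / h) ^ k
      = (\<Sum>i\<le>k. of_nat (k choose i) * x ^ i * (- \<kappa>) ^ (k - i)) / h ^ k" for x
    using binomial_ring[of x "- \<kappa>" k] by (simp add: power_divide)
  show ?thesis
    unfolding moment_def normalize_signal_def moment_shift_def
    by (simp add: expand sum_distrib_left sum_divide_distrib mult_ac sum.swap[of _ "{..k}"])
qed

lemma moment_shift_cong:
  "(\<And>i. i \<le> k \<Longrightarrow> v i = w i) \<Longrightarrow> moment_shift \<kappa> h v k = moment_shift \<kappa> h w k"
  by (simp add: moment_shift_def)

lemma moment_shift_diff:
  "moment_shift \<kappa> h v k - moment_shift \<kappa> h w k = moment_shift \<kappa> h (\<lambda>i. v i - w i) k"
  by (simp add: moment_shift_def diff_divide_distrib[symmetric] sum_subtractf[symmetric] algebra_simps)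

text \<open>After termwise estimation the binomial coefficients sum to
  \<open>(1 + \<bar>\<kappa>\<bar>) ^ k\<close>; this is the origin of the factor
  \<open>1 + \<bar>\<kappa>\<bar>\<close> in \<open>h'\<close>.\<close>

lemma moment_shift_diff_le:
  assumes "0 < h" "\<And>i. i \<le> k \<Longrightarrow> \<bar>v i - w i\<bar> \<le> D"
  shows "\<bar>moment_shift \<kappa> h v k - moment_shift \<kappa> h w k\<bar> \<le> D * ((1 + \<bar>\<kappa>\<bar>) / h) ^ k"
proof -
  have "\<bar>\<Sum>i\<le>k. of_nat (k choose i) * (- \<kappa>) ^ (k - i) * (v i - w i)\<bar>
      \<le> (\<Sum>i\<le>k. of_nat (k choose i) * \<bar>\<kappa>\<bar> ^ (k - i) * D)"
    by (rule order_trans[OF sum_abs], rule sum_mono)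
      (auto simp: abs_mult power_abs intro!: mult_left_mono assms)
  also have "\<dots> = D * (1 + \<bar>\<kappa>\<bar>) ^ k"
    using binomial_ring[of 1 "\<bar>\<kappa>\<bar>" k] by (simp add: sum_distrib_left mult_ac)
  finally show ?thesis
    using assms(1) unfolding moment_shift_diff
    by (simp add: moment_shift_def abs_divide power_divide divide_right_mono)
qed

text \<open>In the top term \<open>i = q\<close> the binomial coefficient is 1 and the power of
  \<open>\<kappa>\<close> is trivial.\<close>

lemma moment_shift_perturb:
  "moment_shift \<kappa> h (\<lambda>i. w i + (if i = q then \<delta> else 0)) q = moment_shift \<kappa> h w q + \<delta> / h ^ q"
proof -
  have "moment_shift \<kappa> h (\<lambda>i. w i + (if i = q then \<delta> else 0)) q - moment_shift \<kappa> h w q = \<delta> / h ^ q"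
    unfolding moment_shift_diff by (simp add: moment_shift_def if_distrib[of "times _"] cong: if_cong)
  then show ?thesis by simp
qed

text \<open>The transformation of the moments is triangular with diagonal entries \<open>1 / h ^ k\<close>.\<close>

lemma moment_shift_inj:
  assumes "0 < h" "\<And>k. k \<le> n \<Longrightarrow> moment_shift \<kappa> h v k = moment_shift \<kappa> h w k" "k \<le> n"
  shows "v k = w k"
  using assms(3)
proof (induction k rule: less_induct)
  case (less k)
  \<comment> \<open>By induction \<open>v\<close> and \<open>w\<close> agree below \<open>k\<close>,
    so up to \<open>k\<close> the sequence \<open>v\<close> is \<open>w\<close> with its last entry
    corrected.\<close>
  then have "moment_shift \<kappa> h v k = moment_shift \<kappa> h (\<lambda>i. w i + (if i = k then v k - w k else 0)) k"
    by (intro moment_shift_cong) auto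
  with assms(1,2) less.prems show ?case
    by (simp add: moment_shift_perturb)
qed

section \<open>Normalized signals and regularity of the model\<close>

lemma normalize_signal_mem_signals:
  "0 < h \<Longrightarrow> F \<in> signals \<Longrightarrow> normalize_signal \<kappa> h F \<in> signals"
  by (auto simp: signals_def normalize_signal_def strict_mono_def divide_strict_right_mono)

definition denormalize_signal :: "real \<Rightarrow> real \<Rightarrow> 'd::finite signal \<Rightarrow> 'd signal" where
  "denormalize_signal \<kappa> h G = (fst G, \<chi> j. h * snd G $ j + \<kappa>)"

lemma normalize_denormalize_signal:
  "0 < h \<Longrightarrow> normalize_signal \<kappa> h (denormalize_signal \<kappa> h G) = G"
  by (simp add: normalize_signal_def denormalize_signal_def vec_eq_iff prod_eq_iff)

lemma denormalize_signal_mem_signals: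
  "0 < h \<Longrightarrow> G \<in> signals \<Longrightarrow> denormalize_signal \<kappa> h G \<in> signals"
  by (auto simp: signals_def denormalize_signal_def strict_mono_def)

lemma half_width_pos:
  fixes F :: "'d::{finite,linorder} signal"
  assumes "CARD('d) \<ge> 2" "F \<in> signals"
  shows "0 < half_width F"
proof -
  have "Min (UNIV :: 'd set) \<noteq> Max UNIV"
  proof
    assume eq: "Min (UNIV :: 'd set) = Max UNIV"
    have "i = Min UNIV" for i :: 'd
      using eq by (metis Min_le Max_ge finite antisym UNIV_I)
    then have "CARD('d) = 1" by (metis card_1_singleton_iff UNIV_eq_I singletonI One_nat_def)
    with assms(1) show False by simp
  qed
  then have "Min (UNIV :: 'd set) < Max UNIV"
    using Min_le[of UNIV "Max (UNIV :: 'd set)"] by (simp add: order_less_le)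
  with assms(2) show ?thesis
    by (auto simp: half_width_def signals_def strict_mono_def)
qed

text \<open>Normalization sends the extreme nodes to -1 and 1 and divides all gaps by
  \<open>h\<close>, so the inversion constants become available at the model signal.\<close>

lemma regular_signal_model_signal:
  fixes F :: "'d::{finite,linorder} signal"
  assumes "CARD('d) \<ge> 2" and rc: "regular_cluster h \<kappa> \<eta> m M F"
  shows "regular_signal \<eta> m M (model_signal F)"
proof -
  have F: "F \<in> signals" and h: "h = half_width F" and k: "\<kappa> = center F"
    using rc by (auto simp: regular_cluster_def)
  have pos: "0 < h"
    using half_width_pos[OF assms(1) F] h by simp
  have mono: "mono (\<lambda>j. snd F $ j)"
    using F by (auto simp: signals_def strict_mono_mono)
  have "(snd F $ j - \<kappa>) / h \<in> {-1..1}" for j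
  proof -
    have "snd F $ Min UNIV \<le> snd F $ j" "snd F $ j \<le> snd F $ Max UNIV"
      using monoD[OF mono] by simp_all
    then have "\<bar>snd F $ j - \<kappa>\<bar> \<le> h"
      by (simp add: h k half_width_def center_def abs_le_iff field_simps)
    with pos show ?thesis by (simp add: abs_le_iff field_simps)
  qed
  moreover have "(snd F $ j - \<kappa>) / h - (snd F $ i - \<kappa>) / h \<ge> \<eta>" if "neighbors i j" for i j
  proof -
    have "\<eta> * h \<le> snd F $ j - snd F $ i"
      using rc that by (auto simp: regular_cluster_def)
    with pos show ?thesis
      by (simp add: diff_divide_distrib[symmetric] pos_le_divide_eq)
  qed
  ultimately show ?thesis
    using rc normalize_signal_mem_signals[OF pos F, of \<kappa>]
    by (auto simp: regular_signal_def model_signal_def h[symmetric] k[symmetric]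
        normalize_signal_def regular_cluster_def abs_le_iff)
qed

section \<open>Estimates for the Hausdorff distance\<close>

lemma hausdorff_distance_le:
  assumes "\<And>u. u \<in> A \<Longrightarrow> \<exists>v\<in>B. infnorm (u - v) \<le> D"
    and "\<And>u. u \<in> B \<Longrightarrow> \<exists>v\<in>A. infnorm (u - v) \<le> D"
  shows "hausdorff_distance A B \<le> ennreal D"
  unfolding hausdorff_distance_def
  by (intro max.boundedI SUP_least) (meson assms INF_lower2 ennreal_leI)+

lemma hausdorff_distance_ge:
  assumes "u \<in> B" "\<And>v. v \<in> A \<Longrightarrow> D \<le> infnorm (u - v)"
  shows "ennreal D \<le> hausdorff_distance A B"
proof -
  have "ennreal D \<le> (INF v\<in>A. ennreal (infnorm (u - v)))"
    by (intro INF_greatest ennreal_leI assms)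
  also have "\<dots> \<le> (SUP u\<in>B. INF v\<in>A. ennreal (infnorm (u - v)))"
    using assms(1) by (rule SUP_upper)
  finally show ?thesis
    unfolding hausdorff_distance_def by (simp add: max.coboundedI2)
qed

lemma INF_infnorm_le:
  assumes "\<And>v. v \<in> B \<Longrightarrow> \<exists>w\<in>C. infnorm (u' - w) \<le> infnorm (u - v) + D" "0 \<le> D"
  shows "(INF w\<in>C. ennreal (infnorm (u' - w))) \<le> (INF v\<in>B. ennreal (infnorm (u - v))) + ennreal D"
proof -
  have "(INF w\<in>C. ennreal (infnorm (u' - w))) \<le> ennreal (infnorm (u - v)) + ennreal D"
    if v: "v \<in> B" for v
  proof -
    obtain w where "w \<in> C" "infnorm (u' - w) \<le> infnorm (u - v) + D"
      using assms(1)[OF v] by blast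
    then have "(INF w\<in>C. ennreal (infnorm (u' - w))) \<le> ennreal (infnorm (u - v) + D)"
      by (intro INF_lower2 ennreal_leI)
    then show ?thesis
      using assms(2) by (simp add: infnorm_pos_le)
  qed
  \<comment> \<open>Moving \<open>D\<close> to the left lets the infimum over \<open>B\<close> be
    handled as a greatest lower bound; an empty \<open>B\<close> is covered, its infimum being
    infinite.\<close>
  then have "(INF w\<in>C. ennreal (infnorm (u' - w))) - ennreal D
      \<le> (INF v\<in>B. ennreal (infnorm (u - v)))"
    by (intro INF_greatest) (simp add: ennreal_minus_le_iff add.commute)
  then show ?thesis
    by (simp add: ennreal_minus_le_iff add.commute)
qed

text \<open>The triangle inequality through \<open>B\<close>, with the distance from
  \<open>B\<close> to \<open>C\<close> given by pointwise witnesses. Each one-sided part of the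
  distance uses one of the two witness assumptions.\<close>

lemma hausdorff_distance_perturb:
  assumes D: "0 \<le> D"
    and BC: "\<And>u. u \<in> B \<Longrightarrow> \<exists>v\<in>C. infnorm (u - v) \<le> D"
    and CB: "\<And>u. u \<in> C \<Longrightarrow> \<exists>v\<in>B. infnorm (u - v) \<le> D"
  shows "hausdorff_distance A C \<le> hausdorff_distance A B + ennreal D"
proof -
  have tri: "infnorm (x - z) \<le> infnorm (x - y) + infnorm (y - z)" for x y z :: 'a
    using infnorm_triangle[of "x - y" "y - z"] by simp
  have "(INF v\<in>C. ennreal (infnorm (u - v))) \<le> hausdorff_distance A B + ennreal D"
    if "u \<in> A" for u
  proof -
    have "(INF v\<in>C. ennreal (infnorm (u - v))) \<le> (INF v\<in>B. ennreal (infnorm (u - v))) + ennreal D"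
      using D
    proof (rule INF_infnorm_le[rotated])
      fix v assume "v \<in> B"
      then obtain w where "w \<in> C" "infnorm (v - w) \<le> D" using BC by blast
      with tri[of u w v] show "\<exists>w\<in>C. infnorm (u - w) \<le> infnorm (u - v) + D"
        by (intro bexI[of _ w]) linarith+
    qed
    moreover have "(INF v\<in>B. ennreal (infnorm (u - v))) \<le> hausdorff_distance A B"
      unfolding hausdorff_distance_def using that by (intro max.coboundedI1 SUP_upper)
    ultimately show ?thesis by (meson add_right_mono order_trans)
  qed
  moreover have "(INF v\<in>A. ennreal (infnorm (u - v))) \<le> hausdorff_distance A B + ennreal D"
    if u: "u \<in> C" for u
  proof -
    obtain w where w: "w \<in> B" "infnorm (u - w) \<le> D" using CB[OF u] by blast
    have "(INF v\<in>A. ennreal (infnorm (u - v))) \<le> (INF v\<in>A. ennreal (infnorm (w - v))) + ennreal D"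
      using D
    proof (rule INF_infnorm_le[rotated])
      fix v assume "v \<in> A"
      with tri[of u v w] w(2) show "\<exists>w'\<in>A. infnorm (u - w') \<le> infnorm (w - v) + D"
        by (intro bexI[of _ v]) linarith+
    qed
    moreover have "(INF v\<in>A. ennreal (infnorm (w - v))) \<le> hausdorff_distance A B"
      unfolding hausdorff_distance_def using w(1) by (intro max.coboundedI2 SUP_upper)
    ultimately show ?thesis by (meson add_right_mono order_trans)
  qed
  ultimately show ?thesis
    by (subst hausdorff_distance_def) (intro max.boundedI SUP_least)
qed

section \<open>Slices of the moment box\<close>

text \<open>The prescribed moments \<open>p\<close> form a sequence instead of coming from a signal,
  so that the slice can be varied as a function of a point in moment space.\<close>

definition moment_fiber ::
    "nat \<Rightarrow> (nat \<Rightarrow> real) \<Rightarrow> 'd::{finite,linorder} signal \<Rightarrow> (nat \<Rightarrow> real) \<Rightarrow> 'd signal set" where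
  "moment_fiber q \<beta> G p =
     {u \<in> signals. (\<forall>k \<le> 2 * CARD('d) - 1. \<bar>moment k u - moment k G\<bar> \<le> \<beta> k) \<and>
                   (\<forall>k \<le> q. moment k u = p k)}"

lemma local_prony_variety_eq_moment_fiber:
  "local_prony_variety q \<epsilon> F G' =
     moment_fiber q (\<lambda>k. \<epsilon> * (1 / scaled_width F) ^ k) (model_signal F) (\<lambda>k. moment k G')"
  by (auto simp: local_prony_variety_def prony_variety_def moment_box_def moment_fiber_def)

lemma moment_fiber_cong:
  "(\<And>k. k \<le> q \<Longrightarrow> p k = p' k) \<Longrightarrow> moment_fiber q \<beta> G p = moment_fiber q \<beta> G p'"
  by (auto simp: moment_fiber_def)

text \<open>Overwrite the moments of \<open>u\<close> up to index \<open>q\<close> by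
  \<open>p'\<close> and keep the others. The result stays in the box, hence belongs to a signal, and
  no moment has moved by more than \<open>D\<close>.\<close>

lemma moment_fiber_close:
  fixes G :: "'d::{finite,linorder} signal"
  assumes ic: "inversion_constants TYPE('d) \<eta> m M R C3 C4" and reg: "regular_signal \<eta> m M G"
    and q: "q \<le> 2 * CARD('d) - 1"
    and \<beta>: "\<And>k. k \<le> 2 * CARD('d) - 1 \<Longrightarrow> \<beta> k \<le> R"
    and p': "\<And>k. k \<le> q \<Longrightarrow> \<bar>p' k - moment k G\<bar> \<le> \<beta> k"
    and D: "0 \<le> D" "\<And>k. k \<le> q \<Longrightarrow> \<bar>p k - p' k\<bar> \<le> D"
    and u: "u \<in> moment_fiber q \<beta> G p"
  shows "\<exists>v\<in>moment_fiber q \<beta> G p'. infnorm (u - v) \<le> C4 * D"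
proof -
  let ?f = "\<lambda>k. if k \<le> q then p' k else moment k u"
  have f: "\<bar>?f k - moment k G\<bar> \<le> \<beta> k" if "k \<le> 2 * CARD('d) - 1" for k
    using p' u that by (auto simp: moment_fiber_def)
  obtain v :: "'d signal" where v: "v \<in> signals"
      "\<And>k. k \<le> 2 * CARD('d) - 1 \<Longrightarrow> moment k v = ?f k"
    using signal_with_moments[OF ic reg order_trans[OF f \<beta>]] by blast
  have "v \<in> moment_fiber q \<beta> G p'"
    using v f q by (auto simp: moment_fiber_def)
  moreover have "infnorm (u - v) \<le> C4 * D"
  proof (rule signal_diff_moment_bounds(2)[OF ic reg])
    show "u \<in> signals" "v \<in> signals" using u v by (auto simp: moment_fiber_def)
    fix k assume k: "k \<le> 2 * CARD('d) - 1"
    show "\<bar>moment k u - moment k G\<bar> \<le> R"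
      using u k \<beta>[OF k] by (force simp: moment_fiber_def)
    show "\<bar>moment k v - moment k G\<bar> \<le> R"
      using v(2)[OF k] f[OF k] \<beta>[OF k] by simp
    show "\<bar>moment k u - moment k v\<bar> \<le> D"
      using v(2)[OF k] u D by (auto simp: moment_fiber_def)
  qed
  ultimately show ?thesis using q by blast
qed

section \<open>Attainment of the worst case error and its two bounds\<close>

theorem theorem6p4:
  fixes F :: "'d::{finite,linorder} signal"
    and h h' \<kappa> \<eta> m M R C3 C4 \<epsilon> \<epsilon>' :: real
    and q :: nat
  assumes "CARD('d) \<ge> 2"
    and "0 < m" and "m \<le> M" and "0 < \<eta>"
    and "inversion_constants TYPE('d) \<eta> m M R C3 C4"
    and "regular_cluster h \<kappa> \<eta> m M F"
    and "\<epsilon>' = \<epsilon> / (1 + \<bar>\<kappa>\<bar>) ^ (2 * CARD('d) - 1)"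
    and "h' = h / (1 + \<bar>\<kappa>\<bar>)"
    and "0 < \<epsilon>" and "\<epsilon> \<le> h' ^ (2 * CARD('d) - 1) * R"
    and "q \<le> 2 * CARD('d) - 1"
  shows "ennreal (C3 * \<epsilon>' * (1 / h) ^ q) \<le> worst_prony_error q F \<epsilon> \<and>
         worst_prony_error q F \<epsilon> \<le> ennreal (C4 * \<epsilon> * (1 / h') ^ q)"
proof -
  let ?N = "2 * CARD('d) - 1"
  let ?G = "model_signal F"
  let ?g = "\<lambda>k. moment k ?G"
  let ?s = "moment_shift \<kappa> h"
  define \<beta> where "\<beta> = (\<lambda>k. \<epsilon> * (1 / h') ^ k)"
  define V where "V = (\<lambda>p. moment_fiber q \<beta> ?G p)"
  define dist_to where "dist_to = (\<lambda>p. hausdorff_distance (V ?g) (V p))"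
  have ic: "inversion_constants TYPE('d) \<eta> m M R C3 C4" by fact
  have C: "0 < C3" "0 < C4" using ic by (auto simp: inversion_constants_def)
  have F: "F \<in> signals" and hw: "half_width F = h" and ce: "center F = \<kappa>" and h2: "h \<le> 1 / 2"
    using assms(6) by (auto simp: regular_cluster_def)
  have h: "0 < h" using half_width_pos[OF assms(1) F] hw by simp
  \<comment> \<open>\<open>h' \<le> 1\<close> makes \<open>\<beta>\<close> nondecreasing, so the
    assumption on \<open>\<epsilon>\<close>, which says \<open>\<beta> ?N \<le> R\<close>, bounds
    every \<open>\<beta> k\<close>.\<close>
  have h': "0 < h'" "h' \<le> 1"
    using h h2 assms(8) by (auto simp: divide_le_eq)
  have sw: "scaled_width F = h'" by (simp add: scaled_width_def hw ce assms(8))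
  have reg: "regular_signal \<eta> m M ?G"
    using assms(1,6) by (rule regular_signal_model_signal)
  have G: "?g k = ?s (\<lambda>i. moment i F) k" for k
    by (simp add: model_signal_def hw ce moment_normalize_signal)
  have \<beta>_mono: "\<beta> i \<le> \<beta> k" if "i \<le> k" for i k
    using h' assms(9) that by (simp add: \<beta>_def power_increasing)
  have \<beta>_pos: "0 < \<beta> k" for k using h' assms(9) by (simp add: \<beta>_def)
  have "\<beta> ?N \<le> R"
    using assms(10) h' by (simp add: \<beta>_def power_one_over field_simps)
  then have \<beta>R: "\<beta> k \<le> R" if "k \<le> ?N" for k
    using \<beta>_mono[OF that] by simp
  have shift_box: "\<bar>?s w k - ?g k\<bar> \<le> \<beta> k"
    if "\<And>i. i \<le> k \<Longrightarrow> \<bar>w i - moment i F\<bar> \<le> \<epsilon>" for w k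
    using moment_shift_diff_le[OF h, of k w "\<lambda>i. moment i F" \<epsilon> \<kappa>] that by (simp add: G \<beta>_def assms(8))
  \<comment> \<open>Every perturbation of the moments of \<open>F\<close> by at most
    \<open>\<epsilon>\<close> is realized: its shifted moments stay within \<open>R\<close> of those
    of the model, so they belong to a signal, which is then denormalized.\<close>
  have realize: "\<exists>G'\<in>normalized_error_set \<epsilon> F. G' \<in> signals \<and> (\<forall>k \<le> ?N. moment k G' = ?s w k)"
    if w: "\<And>i. i \<le> ?N \<Longrightarrow> \<bar>w i - moment i F\<bar> \<le> \<epsilon>" for w
  proof -
    have "\<bar>?s w k - ?g k\<bar> \<le> R" if "k \<le> ?N" for k
      using shift_box[of k w] w that \<beta>R[OF that] by fastforce
    then obtain G' :: "'d signal" where G': "G' \<in> signals" "\<And>k. k \<le> ?N \<Longrightarrow> moment k G' = ?s w k"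
      using signal_with_moments[OF ic reg, of "?s w"] by blast
    let ?F' = "denormalize_signal \<kappa> h G'"
    have norm: "normalize_signal \<kappa> h ?F' = G'"
      using h by (rule normalize_denormalize_signal)
    \<comment> \<open>Both sequences have the same shifted moments, and the shift is
      injective.\<close>
    have "moment k ?F' = w k" if "k \<le> ?N" for k
      using h _ that
    proof (rule moment_shift_inj)
      fix k assume "k \<le> ?N"
      then show "?s (\<lambda>i. moment i ?F') k = ?s w k"
        using G'(2) norm by (metis moment_normalize_signal)
    qed
    then have "?F' \<in> error_set \<epsilon> F"
      using w denormalize_signal_mem_signals[OF h G'(1)] by (simp add: error_set_def)
    then have "G' \<in> normalized_error_set \<epsilon> F"
      unfolding normalized_error_set_def hw ce by (metis norm imageI)
    with G' show ?thesis by blast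
  qed
  \<comment> \<open>\<open>K\<close> is the parallelepiped of the moments of the normalized error
    set.\<close>
  define K where "K = (\<lambda>\<omega>. moment_vector (?s (moment_entry \<omega>)) :: real ^ ('d bit0)) ` cube \<epsilon> (PM F)"
  have "continuous_on (cube \<epsilon> (PM F)) (\<lambda>\<omega>. moment_vector (?s (moment_entry \<omega>)) :: real ^ ('d bit0))"
    unfolding moment_vector_def moment_shift_def moment_entry_def
    using h by (intro continuous_intros) auto
  then have "compact K"
    unfolding K_def using compact_cube by (rule compact_continuous_image)
  have "K \<noteq> {}"
    using assms(9) by (auto simp: K_def cube_def infnorm_0 intro!: exI[of _ "PM F"])
  have K_box: "\<bar>moment_entry p k - ?g k\<bar> \<le> \<beta> k" if "p \<in> K" "k \<le> ?N" for p k
  proof -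
    from \<open>p \<in> K\<close> obtain \<omega> where \<omega>: "\<omega> \<in> cube \<epsilon> (PM F)" "p = moment_vector (?s (moment_entry \<omega>))"
      by (auto simp: K_def)
    have "\<bar>moment_entry \<omega> i - moment i F\<bar> \<le> \<epsilon>" if "i \<le> k" for i
      using \<omega>(1) abs_moment_entry_diff_le[of \<omega> i "PM F"] that \<open>k \<le> ?N\<close>
      by (simp add: cube_def PM_eq_moment_vector moment_entry_moment_vector)
    then show ?thesis
      using \<omega>(2) \<open>k \<le> ?N\<close> shift_box[of k "moment_entry \<omega>"] by (simp add: moment_entry_moment_vector)
  qed
  have close: "hausdorff_distance A (V p') \<le> hausdorff_distance A (V p) + ennreal (C4 * D)"
    if "\<And>k. k \<le> q \<Longrightarrow> \<bar>p k - ?g k\<bar> \<le> \<beta> k" "\<And>k. k \<le> q \<Longrightarrow> \<bar>p' k - ?g k\<bar> \<le> \<beta> k"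
      "0 \<le> D" "\<And>k. k \<le> q \<Longrightarrow> \<bar>p k - p' k\<bar> \<le> D" for A p p' D
    unfolding V_def using that C(2)
    by (intro hausdorff_distance_perturb moment_fiber_close[OF ic reg assms(11) \<beta>R])
      (auto simp: abs_minus_commute)
  have dist_self: "hausdorff_distance A A = 0" for A :: "'d signal set"
  proof -
    have "\<exists>v\<in>A. infnorm (u - v) \<le> 0" if "u \<in> A" for u
      using that by (intro bexI[of _ u]) (simp_all add: infnorm_0)
    then show ?thesis using hausdorff_distance_le[of A A 0] by simp
  qed
  \<comment> \<open>Start at the slice through the model, at distance 0 from itself; the first
    \<open>q + 1\<close> coordinates move by at most \<open>\<beta> q\<close>.\<close>
  have upper: "dist_to p \<le> ennreal (C4 * \<beta> q)" if "\<And>k. k \<le> q \<Longrightarrow> \<bar>p k - ?g k\<bar> \<le> \<beta> k" for p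
  proof -
    have "\<bar>?g k - p k\<bar> \<le> \<beta> q" if "k \<le> q" for k
      using \<open>\<And>k. k \<le> q \<Longrightarrow> \<bar>p k - ?g k\<bar> \<le> \<beta> k\<close>[OF that] \<beta>_mono[OF that] by simp
    then show ?thesis
      using close[of ?g p "\<beta> q" "V ?g"] that \<beta>_pos by (simp add: dist_to_def dist_self less_imp_le)
  qed
  \<comment> \<open>Attainment of the supremum is applied to a real function. \<open>upper\<close>
    makes the distance finite on \<open>K\<close>, so \<open>enn2real\<close> does not hit its
    default value 0 at infinity there.\<close>
  define r where "r = (\<lambda>p :: real ^ ('d bit0). enn2real (dist_to (moment_entry p)))"
  have r: "ennreal (r p) = dist_to (moment_entry p)" if "p \<in> K" for p
  proof -
    have "dist_to (moment_entry p) \<le> ennreal (C4 * \<beta> q)"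
      using K_box[OF that] assms(11) by (intro upper) simp
    then have "dist_to (moment_entry p) < top"
      using ennreal_less_top by (rule le_less_trans)
    then show ?thesis by (simp add: r_def)
  qed
  have r_nonneg: "0 \<le> r p" for p
    by (simp add: r_def)
  have r_le: "r p' \<le> r p + C4 * dist p p'" if "p \<in> K" "p' \<in> K" for p p'
  proof -
    \<comment> \<open>The Euclidean norm dominates the maximum norm, so \<open>dist\<close> may
      serve as the coordinate bound.\<close>
    have "\<bar>moment_entry p k - moment_entry p' k\<bar> \<le> dist p p'" for k
      using abs_moment_entry_diff_le infnorm_le_norm unfolding dist_norm by (rule order_trans)
    then have "dist_to (moment_entry p') \<le> dist_to (moment_entry p) + ennreal (C4 * dist p p')"
      unfolding dist_to_def using K_box that assms(11) by (intro close) auto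
    then have "ennreal (r p') \<le> ennreal (r p) + ennreal (C4 * dist p p')"
      unfolding r[OF that(1)] r[OF that(2)] .
    also have "\<dots> = ennreal (r p + C4 * dist p p')"
      using C(2) r_nonneg by simp
    finally show ?thesis
      using C(2) r_nonneg by (simp del: ennreal_plus)
  qed
  have "C4-lipschitz_on K r"
  proof (rule lipschitz_onI)
    fix p p' assume "p \<in> K" "p' \<in> K"
    with r_le[of p p'] r_le[of p' p] show "dist (r p) (r p') \<le> C4 * dist p p'"
      by (simp add: dist_real_def dist_commute abs_le_iff)
  qed (use C(2) in simp)
  then have "continuous_on K r" by (rule lipschitz_on_continuous_on)
  then obtain p where p: "p \<in> K" "\<And>p'. p' \<in> K \<Longrightarrow> r p' \<le> r p"
    using continuous_attains_sup[OF \<open>compact K\<close> \<open>K \<noteq> {}\<close>] by metis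
  let ?E = "(\<lambda>G'. hausdorff_distance (local_prony_variety q \<epsilon> F ?G) (local_prony_variety q \<epsilon> F G'))
              ` normalized_error_set \<epsilon> F"
  have E_elem: "hausdorff_distance (local_prony_variety q \<epsilon> F ?G) (local_prony_variety q \<epsilon> F G')
      = dist_to (\<lambda>k. moment k G')" for G'
    by (simp add: dist_to_def V_def \<beta>_def local_prony_variety_eq_moment_fiber sw)
  have dist_cong: "dist_to p = dist_to p'" if "\<And>k. k \<le> ?N \<Longrightarrow> p k = p' k" for p p'
    unfolding dist_to_def V_def
    using that assms(11) by (intro arg_cong2[of _ _ _ _ hausdorff_distance] moment_fiber_cong) auto
  \<comment> \<open>One inclusion normalizes members of the error set, the other is
    \<open>realize\<close>. The maximum of \<open>r\<close> on \<open>K\<close> is thus the value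
    denoted by \<open>GREATEST\<close>.\<close>
  have "?E = (\<lambda>p. ennreal (r p)) ` K"
  proof (intro equalityI image_subsetI)
    fix G' assume "G' \<in> normalized_error_set \<epsilon> F"
    then obtain F' where F': "F' \<in> error_set \<epsilon> F" "G' = normalize_signal \<kappa> h F'"
      by (auto simp: normalized_error_set_def hw ce)
    let ?p = "moment_vector (?s (moment_entry (PM F'))) :: real ^ ('d bit0)"
    have "PM F' \<in> cube \<epsilon> (PM F)"
      using F'(1) mem_cube_PM_iff unfolding PM_eq_moment_vector[of F'] error_set_def by blast
    then have "?p \<in> K" by (auto simp: K_def)
    \<comment> \<open>Entries of \<open>PM F'\<close> are known to be moments only up to
      \<open>?N\<close>; the congruence rule keeps the sum in that range.\<close>
    moreover have "moment k G' = moment_entry ?p k" if "k \<le> ?N" for k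
      using that
      by (simp add: moment_entry_moment_vector F'(2) moment_normalize_signal PM_eq_moment_vector
          cong: moment_shift_cong)
    ultimately show "hausdorff_distance (local_prony_variety q \<epsilon> F ?G) (local_prony_variety q \<epsilon> F G')
        \<in> (\<lambda>p. ennreal (r p)) ` K"
      unfolding E_elem using r dist_cong by (metis image_eqI)
  next
    fix p assume "p \<in> K"
    then obtain \<omega> where \<omega>: "\<omega> \<in> cube \<epsilon> (PM F)" "p = moment_vector (?s (moment_entry \<omega>))"
      by (auto simp: K_def)
    have "\<bar>moment_entry \<omega> i - moment i F\<bar> \<le> \<epsilon>" if "i \<le> ?N" for i
      using \<omega>(1) abs_moment_entry_diff_le[of \<omega> i "PM F"] that
      by (simp add: cube_def PM_eq_moment_vector moment_entry_moment_vector)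
    then obtain G' where G': "G' \<in> normalized_error_set \<epsilon> F"
        "\<And>k. k \<le> ?N \<Longrightarrow> moment k G' = ?s (moment_entry \<omega>) k"
      using realize by blast
    have "moment k G' = moment_entry p k" if "k \<le> ?N" for k
      using G'(2) that by (simp add: \<omega>(2) moment_entry_moment_vector)
    then show "ennreal (r p) \<in> ?E"
      unfolding r[OF \<open>p \<in> K\<close>] E_elem using G'(1) dist_cong by (metis image_eqI)
  qed
  with p have worst: "worst_prony_error q F \<epsilon> = ennreal (r p)"
    unfolding worst_prony_error_def by (intro Greatest_equality) (auto intro: ennreal_leI)
  have worst_ge: "e \<le> worst_prony_error q F \<epsilon>" if "e \<in> ?E" for e
    using that p(2) \<open>?E = _\<close> unfolding worst by (auto intro: ennreal_leI)
  have le: "worst_prony_error q F \<epsilon> \<le> ennreal (C4 * \<epsilon> * (1 / h') ^ q)"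
    unfolding worst r[OF p(1)]
    using upper[of "moment_entry p"] K_box[OF p(1)] assms(11) by (simp add: \<beta>_def mult.assoc)
  \<comment> \<open>Only the moment of index \<open>q\<close> is changed, by the largest admissible
    amount.\<close>
  define w where "w = (\<lambda>i. moment i F + (if i = q then \<epsilon> else 0))"
  have w: "\<bar>w i - moment i F\<bar> \<le> \<epsilon>" for i
    using assms(9) by (simp add: w_def)
  obtain G' where G': "G' \<in> normalized_error_set \<epsilon> F" "G' \<in> signals"
      "\<And>k. k \<le> ?N \<Longrightarrow> moment k G' = ?s w k"
    using realize[of w] w by blast
  have "ennreal (C3 * (\<epsilon> / h ^ q)) \<le> dist_to (\<lambda>k. moment k G')"
    unfolding dist_to_def
  proof (rule hausdorff_distance_ge)
    show "G' \<in> V (\<lambda>k. moment k G')"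
      using G'(2,3) shift_box w by (simp add: V_def moment_fiber_def)
    fix v assume v: "v \<in> V ?g"
    \<comment> \<open>The slice also fixes the moment of index \<open>q\<close>, so \<open>v\<close>
      has that of the model while \<open>G'\<close> is off by the diagonal entry times
      \<open>\<epsilon>\<close>.\<close>
    have "moment q G' - moment q v = \<epsilon> / h ^ q"
      using v G'(3)[OF assms(11)] unfolding V_def moment_fiber_def
      by (simp add: G w_def moment_shift_perturb)
    moreover have "C3 * \<bar>moment q G' - moment q v\<bar> \<le> infnorm (G' - v)"
    proof (rule signal_diff_moment_bounds(1)[OF ic reg])
      show "G' \<in> signals" "v \<in> signals" using G' v by (auto simp: V_def moment_fiber_def)
      fix k assume k: "k \<le> ?N"
      show "\<bar>moment k G' - ?g k\<bar> \<le> R"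
        using G'(3)[OF k] shift_box[OF w, of k] \<beta>R[OF k] by simp
      show "\<bar>moment k v - ?g k\<bar> \<le> R"
        using v k \<beta>R[OF k] by (force simp: V_def moment_fiber_def)
    qed (rule assms(11))
    ultimately show "C3 * (\<epsilon> / h ^ q) \<le> infnorm (G' - v)"
      using assms(9) h by simp
  qed
  also have "\<dots> \<le> worst_prony_error q F \<epsilon>"
    using G'(1) by (intro worst_ge) (auto simp: E_elem)
  finally have ge: "ennreal (C3 * (\<epsilon> / h ^ q)) \<le> worst_prony_error q F \<epsilon>" .
  \<comment> \<open>The bound with \<open>\<epsilon>\<close> implies the one with
    \<open>\<epsilon>'\<close>, as \<open>1 + \<bar>\<kappa>\<bar>\<close> is at least 1.\<close>
  have "\<epsilon>' \<le> \<epsilon>"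
    using assms(9) by (simp add: assms(7) divide_le_eq mult_le_cancel_left1)
  then have "C3 * \<epsilon>' * (1 / h) ^ q \<le> C3 * (\<epsilon> / h ^ q)"
    using C(1) h by (simp add: power_one_over divide_right_mono)
  with ge le show ?thesis
    by (meson ennreal_leI order_trans)
qed

end
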